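(* Let $f\colon (G_1,K_1,H_1,E_1)\to(G_2,K_2,H_2,E_2)$ be a morphism of trifactorised groups. For $i=1,2$ let $\mathsf{B}(G_i,K_i,H_i,E_i)=(K_i,\cdot,\boxdot)$ be the associated brace and let $\eta_i\colon(K_i,\boxdot)\to E_i$ be the epimorphism that constructs the trifactorised group $(G_i,K_i,H_i,E_i)$. Let $\mathsf{B}(f)=f|_{K_1}$. Then \[\mathsf{B}(f)(\ker\eta_1)\le\ker\eta_2.\]
   Context: A trifactorised group is a tuple $(G,K,H,E)$ with $G$ a group, $K\trianglelefteq G$, $H,E\le G$, $G=KE=KH=HE$ and $K\cap E=H\cap E=1$. A morphism $(G_1,K_1,H_1,E_1)\to(G_2,K_2,H_2,E_2)$ is a group homomorphism $f\colon G_1\to G_2$ with $f(K_1)\le K_2$, $f(H_1)\le H_2$, $f(E_1)\le E_2$. A skew left brace $(B,+,\cdot)$ is a set with two group operations such that $a(b+c)=ab-a+ac$ for all $a,b,c$. The associated brace $\mathsf{B}(G,K,H,E)$ is the skew left brace $(K,\cdot,\boxdot)$: its additive operation is the group operation of $K$ inherited from $G$, and its multiplicative operation is $k_1\boxdot k_2=k_1\,(e_{k_1}k_2e_{k_1}^{-1})$, where for $k\in K$, $e_k$ is the unique element of $E$ with $ke_k\in H$. The epimorphism that constructs $(G,K,H,E)$ is the surjective group homomorphism $\eta\colon(K,\boxdot)\to E$, $\eta(k)=e_k$; thus $H=\{k\,\eta(k)\mid k\in K\}$. *)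

theory Defs
  imports "HOL-Algebra.Algebra"
begin

locale trifactorised_group = group G for G (structure) +
  fixes K H E
  assumes K_normal: "K \<lhd> G"
    and H_subgroup: "subgroup H G"
    and E_subgroup: "subgroup E G"
    and carrier_KE: "carrier G = K <#> E"
    and carrier_KH: "carrier G = K <#> H"
    and carrier_HE: "carrier G = H <#> E"
    and K_Int_E: "K \<inter> E = {\<one>}"
    and H_Int_E: "H \<inter> E = {\<one>}"

definition trifactorised_hom ::
  "('a, 'm) monoid_scheme \<Rightarrow> 'a set \<Rightarrow> 'a set \<Rightarrow> 'a set \<Rightarrow>
   ('b, 'n) monoid_scheme \<Rightarrow> 'b set \<Rightarrow> 'b set \<Rightarrow> 'b set \<Rightarrow> ('a \<Rightarrow> 'b) set" where
  "trifactorised_hom G1 K1 H1 E1 G2 K2 H2 E2 =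
     {f \<in> hom G1 G2. f ` K1 \<subseteq> K2 \<and> f ` H1 \<subseteq> H2 \<and> f ` E1 \<subseteq> E2}"

text \<open>
  A skew left brace is encoded in a \<open>ring\<close> record: \<open>\<oplus>\<close>, \<open>\<zero>\<close> carry the (not necessarily
  commutative) additive group and \<open>\<otimes>\<close>, \<open>\<one>\<close> the multiplicative group.
  Thus \<open>B\<close> itself, read as a monoid, is the multiplicative group.
\<close>

definition skew_left_brace :: "('a, 'm) ring_scheme \<Rightarrow> bool" where
  "skew_left_brace B \<longleftrightarrow> group (add_monoid B) \<and> group B \<and>
     (\<forall>a\<in>carrier B. \<forall>b\<in>carrier B. \<forall>c\<in>carrier B.
        a \<otimes>\<^bsub>B\<^esub> (b \<oplus>\<^bsub>B\<^esub> c) = (a \<otimes>\<^bsub>B\<^esub> b \<ominus>\<^bsub>B\<^esub> a) \<oplus>\<^bsub>B\<^esub> a \<otimes>\<^bsub>B\<^esub> c)"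

text \<open>The value is meaningful only for \<open>k \<in> K\<close>; see \<open>ex1_eta\<close> below.\<close>

definition eta :: "('a, 'm) monoid_scheme \<Rightarrow> 'a set \<Rightarrow> 'a set \<Rightarrow> 'a \<Rightarrow> 'a" where
  "eta G H E k = (THE e. e \<in> E \<and> k \<otimes>\<^bsub>G\<^esub> e \<in> H)"

definition associated_brace ::
  "('a, 'm) monoid_scheme \<Rightarrow> 'a set \<Rightarrow> 'a set \<Rightarrow> 'a set \<Rightarrow> 'a ring" where
  "associated_brace G K H E =
     \<lparr>carrier = K,
      monoid.mult = (\<lambda>k1 k2. k1 \<otimes>\<^bsub>G\<^esub> (eta G H E k1 \<otimes>\<^bsub>G\<^esub> k2 \<otimes>\<^bsub>G\<^esub> inv\<^bsub>G\<^esub> (eta G H E k1))),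
      one = \<one>\<^bsub>G\<^esub>, ring.zero = \<one>\<^bsub>G\<^esub>, ring.add = (\<lambda>k1 k2. k1 \<otimes>\<^bsub>G\<^esub> k2)\<rparr>"

abbreviation ker_eta :: "('a, 'm) monoid_scheme \<Rightarrow> 'a set \<Rightarrow> 'a set \<Rightarrow> 'a set \<Rightarrow> 'a set" where
  "ker_eta G K H E \<equiv> kernel (associated_brace G K H E) (G\<lparr>carrier := E\<rparr>) (eta G H E)"

context trifactorised_group
begin

abbreviation "B \<equiv> associated_brace G K H E"
abbreviation "\<eta> \<equiv> eta G H E"

lemma K_subgroup: "subgroup K G"
  using K_normal normal_imp_subgroup by blast

lemmas K_closed = subgroup.m_closed[OF K_subgroup] subgroup.one_closed[OF K_subgroup]
  subgroup.m_inv_closed[OF K_subgroup]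
lemmas H_closed = subgroup.m_closed[OF H_subgroup] subgroup.one_closed[OF H_subgroup]
  subgroup.m_inv_closed[OF H_subgroup]
lemmas E_closed = subgroup.m_closed[OF E_subgroup] subgroup.one_closed[OF E_subgroup]
  subgroup.m_inv_closed[OF E_subgroup]

lemma K_in: "k \<in> K \<Longrightarrow> k \<in> carrier G" and H_in: "h \<in> H \<Longrightarrow> h \<in> carrier G"
  and E_in: "e \<in> E \<Longrightarrow> e \<in> carrier G"
  using K_subgroup H_subgroup E_subgroup subgroup.mem_carrier by metis+

lemma eta_unique:
  assumes "k \<in> K" "e \<in> E" "k \<otimes> e \<in> H" "e' \<in> E" "k \<otimes> e' \<in> H"
  shows "e = e'"
proof -
  have c: "k \<in> carrier G" "e \<in> carrier G" "e' \<in> carrier G"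
    using assms K_in E_in by auto
  have "inv (k \<otimes> e) \<otimes> (k \<otimes> e') = inv e \<otimes> e'"
    using c by (simp add: inv_mult_group m_assoc inv_solve_left')
  then have "inv e \<otimes> e' \<in> H"
    using assms H_closed by metis
  moreover have "inv e \<otimes> e' \<in> E"
    using assms E_closed by metis
  ultimately have "inv e \<otimes> e' = \<one>" using H_Int_E by blast
  then have "inv e' = inv e" using c by (intro inv_equality) auto
  then have "inv (inv e') = inv (inv e)" by simp
  then show ?thesis using c by simp
qed

lemma ex1_eta: "k \<in> K \<Longrightarrow> \<exists>!e. e \<in> E \<and> k \<otimes> e \<in> H"
proof -
  assume k: "k \<in> K"
  then obtain h e where he: "h \<in> H" "e \<in> E" "k = h \<otimes> e"
    using K_in carrier_HE unfolding set_mult_def by blast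
  then have "k \<otimes> inv e = h" using H_in E_in by (simp add: m_assoc)
  with he have "inv e \<in> E \<and> k \<otimes> inv e \<in> H"
    using E_closed by metis
  then show "\<exists>!e. e \<in> E \<and> k \<otimes> e \<in> H"
    by (intro ex1I[of _ "inv e"]) (auto intro: eta_unique[OF k])
qed

lemma eta_in: "k \<in> K \<Longrightarrow> \<eta> k \<in> E" and eta_H: "k \<in> K \<Longrightarrow> k \<otimes> \<eta> k \<in> H"
  using theI'[OF ex1_eta, of k] unfolding eta_def by simp_all

lemma eta_eq: "\<lbrakk>k \<in> K; e \<in> E; k \<otimes> e \<in> H\<rbrakk> \<Longrightarrow> \<eta> k = e"
  by (rule eta_unique[OF _ eta_in eta_H]) assumption+

lemma conj_K: "\<lbrakk>g \<in> carrier G; k \<in> K\<rbrakk> \<Longrightarrow> g \<otimes> k \<otimes> inv g \<in> K"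
  by (rule normal.inv_op_closed2[OF K_normal])

lemma brace_simps:
  "carrier B = K" "\<one>\<^bsub>B\<^esub> = \<one>" "\<zero>\<^bsub>B\<^esub> = \<one>" "x \<oplus>\<^bsub>B\<^esub> y = x \<otimes> y"
  "x \<otimes>\<^bsub>B\<^esub> y = x \<otimes> (\<eta> x \<otimes> y \<otimes> inv (\<eta> x))"
  by (simp_all add: associated_brace_def)

lemma brace_mult_in: "\<lbrakk>x \<in> K; y \<in> K\<rbrakk> \<Longrightarrow> x \<otimes>\<^bsub>B\<^esub> y \<in> K"
  unfolding brace_simps by (intro subgroup.m_closed[OF K_subgroup] conj_K E_in eta_in)

lemma brace_mult_H:
  assumes "x \<in> K" "y \<in> K"
  shows "(x \<otimes>\<^bsub>B\<^esub> y) \<otimes> (\<eta> x \<otimes> \<eta> y) = (x \<otimes> \<eta> x) \<otimes> (y \<otimes> \<eta> y)"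
proof -
  have c: "x \<in> carrier G" "y \<in> carrier G" "\<eta> x \<in> carrier G" "\<eta> y \<in> carrier G"
    using assms K_in eta_in E_in by auto
  then have "inv (\<eta> x) \<otimes> (\<eta> x \<otimes> \<eta> y) = \<eta> y" by (simp add: inv_solve_left')
  with c show ?thesis by (simp add: brace_simps m_assoc)
qed

lemma eta_mult:
  assumes "x \<in> K" "y \<in> K"
  shows "\<eta> (x \<otimes>\<^bsub>B\<^esub> y) = \<eta> x \<otimes> \<eta> y"
proof (rule eta_eq)
  show "x \<otimes>\<^bsub>B\<^esub> y \<in> K" using assms by (rule brace_mult_in)
  show "\<eta> x \<otimes> \<eta> y \<in> E" using assms by (intro subgroup.m_closed[OF E_subgroup] eta_in)
  show "(x \<otimes>\<^bsub>B\<^esub> y) \<otimes> (\<eta> x \<otimes> \<eta> y) \<in> H"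
    unfolding brace_mult_H[OF assms] using assms by (intro subgroup.m_closed[OF H_subgroup] eta_H)
qed

lemma eta_one: "\<eta> \<one> = \<one>"
  by (rule eta_eq) (simp_all add: K_closed H_closed E_closed)

lemma group_brace_mult: "group B"
proof (rule groupI)
  show "\<one>\<^bsub>B\<^esub> \<in> carrier B"
    by (simp add: brace_simps K_closed)
  show "\<And>x y. x \<in> carrier B \<Longrightarrow> y \<in> carrier B \<Longrightarrow> x \<otimes>\<^bsub>B\<^esub> y \<in> carrier B"
    using brace_mult_in by (simp add: brace_simps(1))
  show "\<one>\<^bsub>B\<^esub> \<otimes>\<^bsub>B\<^esub> x = x" if "x \<in> carrier B" for x
    using that by (simp add: brace_simps eta_one K_in)
next
  fix x y z assume "x \<in> carrier B" "y \<in> carrier B" "z \<in> carrier B"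
  then have xyz: "x \<in> K" "y \<in> K" "z \<in> K" by (simp_all add: brace_simps)
  then have c: "x \<in> carrier G" "y \<in> carrier G" "z \<in> carrier G"
     "\<eta> x \<in> carrier G" "\<eta> y \<in> carrier G" "\<eta> z \<in> carrier G"
    using K_in eta_in E_in by auto
  have a: "inv (\<eta> x) \<otimes> (\<eta> x \<otimes> w) = w" if "w \<in> carrier G" for w
    using c that by (simp add: inv_solve_left')
  have "(x \<otimes>\<^bsub>B\<^esub> y) \<otimes>\<^bsub>B\<^esub> z = (x \<otimes>\<^bsub>B\<^esub> y) \<otimes> ((\<eta> x \<otimes> \<eta> y) \<otimes> z \<otimes> inv (\<eta> x \<otimes> \<eta> y))"
    using eta_mult xyz by (simp add: brace_simps(5)[of "x \<otimes>\<^bsub>B\<^esub> y"])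
  also have "\<dots> = x \<otimes>\<^bsub>B\<^esub> (y \<otimes>\<^bsub>B\<^esub> z)"
    using c a by (simp add: brace_simps m_assoc inv_mult_group)
  finally show "(x \<otimes>\<^bsub>B\<^esub> y) \<otimes>\<^bsub>B\<^esub> z = x \<otimes>\<^bsub>B\<^esub> (y \<otimes>\<^bsub>B\<^esub> z)" .
next
  fix x assume "x \<in> carrier B"
  then have x: "x \<in> K" by (simp add: brace_simps)
  then have c: "x \<in> carrier G" "\<eta> x \<in> carrier G" and e: "\<eta> x \<in> E" using K_in eta_in E_in by auto
  define y where "y = inv (\<eta> x) \<otimes> inv x \<otimes> inv (inv (\<eta> x))"
  have y: "y \<in> K" unfolding y_def
    using x c by (intro conj_K) (auto simp: K_closed)
  have "y \<otimes> inv (\<eta> x) = inv (x \<otimes> \<eta> x)"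
    using c by (simp add: y_def m_assoc inv_mult_group)
  then have "\<eta> y = inv (\<eta> x)"
    using x y e by (intro eta_eq) (auto simp: E_closed H_closed eta_H)
  then have "y \<otimes>\<^bsub>B\<^esub> x = \<one>\<^bsub>B\<^esub>"
    using c by (simp add: brace_simps y_def m_assoc inv_solve_left')
       (simp add: m_assoc[symmetric])
  with y show "\<exists>y\<in>carrier B. y \<otimes>\<^bsub>B\<^esub> x = \<one>\<^bsub>B\<^esub>" by (auto simp: brace_simps(1))
qed

lemma add_monoid_brace: "add_monoid B = \<lparr>carrier = K, monoid.mult = (\<otimes>), one = \<one>\<rparr>"
  by (simp add: associated_brace_def fun_eq_iff)

lemma group_brace_add: "group (add_monoid B)"
  unfolding add_monoid_brace
proof (rule groupI, goal_cases)
  case (5 x)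
  then show ?case by (auto simp: K_closed K_in intro!: bexI[of _ "inv x"])
qed (simp_all add: K_closed m_assoc K_in)

lemma brace_minus: "x \<in> K \<Longrightarrow> \<ominus>\<^bsub>B\<^esub> x = inv x"
proof -
  assume x: "x \<in> K"
  have "inv\<^bsub>add_monoid B\<^esub> x = inv x"
    by (rule group.inv_equality[OF group_brace_add])
      (auto simp: brace_simps x K_in K_closed)
  then show ?thesis by (simp add: a_inv_def)
qed

lemma skew_left_brace_associated_brace: "skew_left_brace B"
  unfolding skew_left_brace_def
proof (intro conjI ballI group_brace_add group_brace_mult)
  fix a b c assume "a \<in> carrier B" "b \<in> carrier B" "c \<in> carrier B"
  then have abc: "a \<in> K" "b \<in> K" "c \<in> K" by (simp_all add: brace_simps)
  then have i: "a \<in> carrier G" "b \<in> carrier G" "c \<in> carrier G" "\<eta> a \<in> carrier G"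
    using K_in eta_in E_in by auto
  have l: "inv u \<otimes> (u \<otimes> w) = w" if "u \<in> carrier G" "w \<in> carrier G" for u w
    using that by (simp add: inv_solve_left')
  show "a \<otimes>\<^bsub>B\<^esub> (b \<oplus>\<^bsub>B\<^esub> c) = (a \<otimes>\<^bsub>B\<^esub> b \<ominus>\<^bsub>B\<^esub> a) \<oplus>\<^bsub>B\<^esub> a \<otimes>\<^bsub>B\<^esub> c"
    using i abc(1) l by (simp add: a_minus_def brace_minus brace_simps m_assoc)
qed

lemma eta_epi: "\<eta> \<in> epi B (G\<lparr>carrier := E\<rparr>)"
proof -
  have "\<exists>k\<in>K. \<eta> k = e" if "e \<in> E" for e
  proof -
    have "e \<in> K <#> H" using E_in[OF \<open>e \<in> E\<close>] carrier_KH by simp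
    then obtain k h where kh: "k \<in> K" "h \<in> H" "e = k \<otimes> h"
      unfolding set_mult_def by blast
    then have "inv k \<otimes> e = h" using K_in H_in by (simp add: inv_solve_left')
    then have "\<eta> (inv k) = e"
      using kh that by (intro eta_eq) (auto simp: K_closed)
    with kh show ?thesis by (auto simp: K_closed)
  qed
  then have "\<eta> ` K = E" using eta_in by force
  then show ?thesis
    unfolding epi_def hom_def by (auto simp: brace_simps(1) eta_mult)
qed

lemma H_eq: "H = (\<lambda>k. k \<otimes> \<eta> k) ` K"
proof
  show "(\<lambda>k. k \<otimes> \<eta> k) ` K \<subseteq> H" using eta_H by auto
  show "H \<subseteq> (\<lambda>k. k \<otimes> \<eta> k) ` K"
  proof
    fix h assume h: "h \<in> H"
    then obtain k e where ke: "k \<in> K" "e \<in> E" "h = k \<otimes> e"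
      using H_in carrier_KE unfolding set_mult_def by blast
    with h have "\<eta> k = e" by (intro eta_eq) auto
    with ke show "h \<in> (\<lambda>k. k \<otimes> \<eta> k) ` K" by auto
  qed
qed

end

definition brace_map :: "'a set \<Rightarrow> ('a \<Rightarrow> 'b) \<Rightarrow> 'a \<Rightarrow> 'b" where
  "brace_map K f = restrict f K"

end

theory Submission
  imports Defs
begin

text \<open>
  A morphism of trifactorised groups intertwines the two epimorphisms:
  \<open>f (\<eta>\<^sub>1 k) = \<eta>\<^sub>2 (f k)\<close>. Both parts of the claim follow from this naturality (\<open>eta_natural\<close>).
  It places \<open>f k\<close> in the kernel of \<open>\<eta>\<^sub>2\<close> whenever \<open>\<eta>\<^sub>1 k = \<one>\<close>; and it makes the restriction of
  \<open>f\<close> a homomorphism of the multiplicative groups of the braces (\<open>brace_map_hom\<close>), so that the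
  image of the kernel of \<open>\<eta>\<^sub>1\<close> is closed under the product and inverses of the second brace.
\<close>

context trifactorised_group
begin

lemma eta_group_hom: "group_hom B (G\<lparr>carrier := E\<rparr>) \<eta>"
  using group_brace_mult subgroup.subgroup_is_group[OF E_subgroup is_group] eta_epi
  by (simp add: group_hom_def group_hom_axioms_def epi_def)

end

text \<open>
  Applying \<open>f\<close> to \<open>k \<otimes> \<eta>\<^sub>1 k \<in> H\<^sub>1\<close> shows that \<open>f (\<eta>\<^sub>1 k)\<close> is an element of \<open>E\<^sub>2\<close> that carries \<open>f k\<close>
  into \<open>H\<^sub>2\<close>; by uniqueness it is \<open>\<eta>\<^sub>2 (f k)\<close>.
\<close>

lemma eta_natural:
  assumes T1: "trifactorised_group G1 K1 H1 E1"
    and T2: "trifactorised_group G2 K2 H2 E2"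
    and f: "f \<in> trifactorised_hom G1 K1 H1 E1 G2 K2 H2 E2"
    and k: "k \<in> K1"
  shows "eta G2 H2 E2 (f k) = f (eta G1 H1 E1 k)"
proof -
  interpret T1: trifactorised_group G1 K1 H1 E1 by (rule T1)
  interpret T2: trifactorised_group G2 K2 H2 E2 by (rule T2)
  let ?e = "eta G1 H1 E1 k"
  have hom: "f \<in> hom G1 G2" and sub: "f ` K1 \<subseteq> K2" "f ` H1 \<subseteq> H2" "f ` E1 \<subseteq> E2"
    using f by (simp_all add: trifactorised_hom_def)
  have "f (k \<otimes>\<^bsub>G1\<^esub> ?e) = f k \<otimes>\<^bsub>G2\<^esub> f ?e"
    using hom k by (intro hom_mult) (auto intro: T1.K_in T1.E_in T1.eta_in)
  then have "f k \<otimes>\<^bsub>G2\<^esub> f ?e \<in> H2"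
    using sub(2) T1.eta_H[OF k] by (metis image_subset_iff)
  then show ?thesis
    using sub k T1.eta_in[OF k] by (intro T2.eta_eq) auto
qed

text \<open>
  The brace product is the group product twisted by conjugation with \<open>\<eta>\<close>. As \<open>f\<close> is a homomorphism
  of the ambient groups, it respects this product once it is compatible with \<open>\<eta>\<close>.
\<close>

lemma brace_map_hom:
  assumes T1: "trifactorised_group G1 K1 H1 E1"
    and T2: "trifactorised_group G2 K2 H2 E2"
    and f: "f \<in> trifactorised_hom G1 K1 H1 E1 G2 K2 H2 E2"
  shows "brace_map K1 f \<in> hom (associated_brace G1 K1 H1 E1) (associated_brace G2 K2 H2 E2)"
proof -
  interpret T1: trifactorised_group G1 K1 H1 E1 by (rule T1)
  interpret T2: trifactorised_group G2 K2 H2 E2 by (rule T2)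
  have hom: "f \<in> hom G1 G2" and sub: "f ` K1 \<subseteq> K2"
    using f by (simp_all add: trifactorised_hom_def)
  interpret f: group_hom G1 G2 f
    using hom by unfold_locales
  have mult: "f (x \<otimes>\<^bsub>T1.B\<^esub> y) = f x \<otimes>\<^bsub>T2.B\<^esub> f y" if xy: "x \<in> K1" "y \<in> K1" for x y
  proof -
    have c: "x \<in> carrier G1" "y \<in> carrier G1" "T1.\<eta> x \<in> carrier G1"
      using xy T1.K_in T1.eta_in T1.E_in by auto
    then show ?thesis
      by (simp add: T1.brace_simps T2.brace_simps eta_natural[OF T1 T2 f xy(1)])
  qed
  show ?thesis
  proof (rule homI)
    fix x assume "x \<in> carrier T1.B"
    then show "brace_map K1 f x \<in> carrier T2.B"
      using sub by (auto simp: brace_map_def T1.brace_simps(1) T2.brace_simps(1))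
  next
    fix x y assume "x \<in> carrier T1.B" "y \<in> carrier T1.B"
    then have xy: "x \<in> K1" "y \<in> K1" by (simp_all add: T1.brace_simps(1))
    show "brace_map K1 f (x \<otimes>\<^bsub>T1.B\<^esub> y) = brace_map K1 f x \<otimes>\<^bsub>T2.B\<^esub> brace_map K1 f y"
      using mult[OF xy] xy T1.brace_mult_in[OF xy] by (simp only: brace_map_def restrict_apply')
  qed
qed

theorem proposition3p11:
  fixes G1 :: "('a, 'm) monoid_scheme" and K1 H1 E1 :: "'a set"
    and G2 :: "('b, 'n) monoid_scheme" and K2 H2 E2 :: "'b set"
    and f :: "'a \<Rightarrow> 'b"
  assumes "trifactorised_group G1 K1 H1 E1"
    and "trifactorised_group G2 K2 H2 E2"
    and "f \<in> trifactorised_hom G1 K1 H1 E1 G2 K2 H2 E2"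
  shows "subgroup (brace_map K1 f ` ker_eta G1 K1 H1 E1)
           ((associated_brace G2 K2 H2 E2)\<lparr>carrier := ker_eta G2 K2 H2 E2\<rparr>)"
proof -
  interpret T1: trifactorised_group G1 K1 H1 E1 by (rule assms(1))
  interpret T2: trifactorised_group G2 K2 H2 E2 by (rule assms(2))
  interpret f: group_hom G1 G2 f
    using assms(3) by unfold_locales (simp add: trifactorised_hom_def)
  have Bf: "group_hom T1.B T2.B (brace_map K1 f)"
    using T1.group_brace_mult T2.group_brace_mult brace_map_hom[OF assms]
    by (simp add: group_hom_def group_hom_axioms_def)
  have image: "subgroup (brace_map K1 f ` ker_eta G1 K1 H1 E1) T2.B"
    by (rule group_hom.subgroup_img_is_subgroup
        [OF Bf group_hom.subgroup_kernel[OF T1.eta_group_hom]])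
  have "brace_map K1 f ` ker_eta G1 K1 H1 E1 \<subseteq> ker_eta G2 K2 H2 E2"
  proof
    fix y assume "y \<in> brace_map K1 f ` ker_eta G1 K1 H1 E1"
    then obtain k where k: "k \<in> K1" "T1.\<eta> k = \<one>\<^bsub>G1\<^esub>" "y = f k"
      by (auto simp: kernel_def T1.brace_simps(1) brace_map_def)
    have "T2.\<eta> y = \<one>\<^bsub>G2\<^esub>"
      using eta_natural[OF assms k(1)] k by simp
    moreover have "y \<in> K2"
      using k assms(3) by (auto simp: trifactorised_hom_def)
    ultimately show "y \<in> ker_eta G2 K2 H2 E2"
      by (simp add: kernel_def T2.brace_simps(1))
  qed
  then show ?thesis
    by (rule group.subgroup_incl[OF T2.group_brace_mult image
        group_hom.subgroup_kernel[OF T2.eta_group_hom]])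
qed

end
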